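(* Let $p\in[1,\infty]$, let $U\subseteq\mathcal{R}$, let $\theta(\mathbf{x})\in\mathbb{R}^{n\times n}$ be an invertible metric function, and let $Q\in\mathbb{R}^{m\times m}$, $R\in\mathbb{R}^{m\times n}$ and $\rho\in\mathbb{R}^{m\times m}$ ($\rho$ invertible) be matrices, possibly depending on $\mathbf{x}$, such that the generalized unreduced Jacobian $F$ determined by $\theta,Q,R,\rho$ satisfies $\mu_p(F)<0$ for every $\mathbf{x}\in U$. Then, for every $\mathbf{x}\in U$, $$\mu_p(F_r)\le \mu_p(F)\,\nu_p(H),$$ where $F_r$ is the generalized reduced Jacobian, $S=\rho D^{-1}C\theta^{-1}\in\mathbb{R}^{m\times n}$, $H=\begin{bmatrix}\mathbb{1}\\ S\end{bmatrix}\in\mathbb{R}^{(n+m)\times n}$, and $\nu_p(H)=\min_{\|v\|_p=1}\|Hv\|_p$ (minimum over $v\in\mathbb{R}^n$).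
   Context: Consider the differential-algebraic (DAE) system $\dot{\mathbf{x}}=\mathbf{f}(\mathbf{x},\mathbf{y})$, $0=\mathbf{g}(\mathbf{x},\mathbf{y})$ with $\mathbf{x}\in\mathbb{R}^n$, $\mathbf{y}\in\mathbb{R}^m$, and $\mathbf{f},\mathbf{g}$ continuously differentiable with values in $\mathbb{R}^n$ and $\mathbb{R}^m$. A solution branch $\mathbf{y}=\mathbf{Y}(\mathbf{x})$ of $\mathbf{g}(\mathbf{x},\mathbf{Y}(\mathbf{x}))=0$ is fixed, and all analysis is restricted to the domain $\mathcal{R}$ of points $\mathbf{x}$ where this branch exists and $\det\left(\partial\mathbf{g}/\partial\mathbf{y}\right)|_{\mathbf{y}=\mathbf{Y}(\mathbf{x})}\neq0$. The reduced system is $\dot{\mathbf{x}}=\mathbf{f}(\mathbf{x},\mathbf{Y}(\mathbf{x}))$. For $\mathbf{x}\in\mathcal{R}$ put $A=\partial\mathbf{f}/\partial\mathbf{x}$, $B=\partial\mathbf{f}/\partial\mathbf{y}$, $C=\partial\mathbf{g}/\partial\mathbf{x}$, $D=\partial\mathbf{g}/\partial\mathbf{y}$, all evaluated at $(\mathbf{x},\mathbf{Y}(\mathbf{x}))$; thus $D$ is invertible. A metric function is a differentiable matrix-valued function $\theta(\mathbf{x})\in\mathbb{R}^{n\times n}$ with invertible values; $\dot\theta=\sum_{i=1}^n\frac{\partial\theta}{\partial x_i}\,f_i(\mathbf{x},\mathbf{Y}(\mathbf{x}))$ is its derivative along trajectories. The generalized reduced Jacobian is $$F_r=\dot\theta\theta^{-1}+\theta(A-BD^{-1}C)\theta^{-1}\in\mathbb{R}^{n\times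 n}.$$ Given auxiliary matrices $Q\in\mathbb{R}^{m\times m}$, $R\in\mathbb{R}^{m\times n}$ and an invertible metric $\rho\in\mathbb{R}^{m\times m}$ for the variable $\mathbf{y}$, the generalized unreduced Jacobian (the Jacobian of the extended system) is $$F=\begin{bmatrix}F_r+\theta R^TC\theta^{-1} & \theta R^TD\rho^{-1}\\ Q^TC\theta^{-1} & Q^TD\rho^{-1}\end{bmatrix}\in\mathbb{R}^{(n+m)\times(n+m)}.$$ For a square real matrix $M$, the matrix measure is $\mu_p(M)=\lim_{h\to0^+}\frac1h\left(\|\mathbb{1}+hM\|_p-1\right)$, where $\|\cdot\|_p$ on matrices is the operator norm induced by the vector $p$-norm and $\mathbb{1}$ is the identity matrix. *)

theory Defs
  imports "HOL-Analysis.Analysis"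
begin

definition pnorm :: "ereal \<Rightarrow> real^'k \<Rightarrow> real" where
  "pnorm p x = (if p = \<infinity> then infnorm x
     else (\<Sum>i\<in>UNIV. \<bar>x $ i\<bar> powr real_of_ereal p) powr (1 / real_of_ereal p))"

definition op_pnorm :: "ereal \<Rightarrow> real^'k^'l \<Rightarrow> real" where
  "op_pnorm p M = (SUP v\<in>{v. pnorm p v = 1}. pnorm p (M *v v))"

definition matrix_measure :: "ereal \<Rightarrow> real^'k^'k \<Rightarrow> real" where
  "matrix_measure p M = Lim (at_right 0) (\<lambda>h. (op_pnorm p (mat 1 + h *\<^sub>R M) - 1) / h)"

definition min_gain :: "ereal \<Rightarrow> real^'k^'l \<Rightarrow> real" where
  "min_gain p M = (LEAST r. r \<in> (\<lambda>v. pnorm p (M *v v)) ` {v. pnorm p v = 1})"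

(* Indices of R^(n+m) are modelled by the sum type, Inl for the x-part and Inr for the y-part. *)

definition vstack :: "real^'c^'n \<Rightarrow> real^'c^'m \<Rightarrow> real^'c^('n + 'm)" where
  "vstack M N = (\<chi> i. case i of Inl a \<Rightarrow> M $ a | Inr b \<Rightarrow> N $ b)"

definition hstack :: "real^'n^'r \<Rightarrow> real^'m^'r \<Rightarrow> real^('n + 'm)^'r" where
  "hstack M N = (\<chi> i j. case j of Inl a \<Rightarrow> M $ i $ a | Inr b \<Rightarrow> N $ i $ b)"

definition block_matrix ::
  "real^'n^'n \<Rightarrow> real^'m^'n \<Rightarrow> real^'n^'m \<Rightarrow> real^'m^'m \<Rightarrow> real^('n + 'm)^('n + 'm)" where
  "block_matrix M11 M12 M21 M22 = vstack (hstack M11 M12) (hstack M21 M22)"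

definition continuously_differentiable ::
  "('a::real_normed_vector \<Rightarrow> 'b::real_normed_vector) \<Rightarrow> bool" where
  "continuously_differentiable F \<longleftrightarrow>
     (\<exists>F' :: 'a \<Rightarrow> 'a \<Rightarrow>\<^sub>L 'b.
        (\<forall>z. (F has_derivative blinfun_apply (F' z)) (at z)) \<and> continuous_on UNIV F')"

definition jac1 ::
  "(real^'n \<Rightarrow> real^'m \<Rightarrow> real^'k) \<Rightarrow> real^'n \<Rightarrow> real^'m \<Rightarrow> real^'n^'k" where
  "jac1 F x y = jacobian (\<lambda>u. F u y) (at x)"

definition jac2 ::
  "(real^'n \<Rightarrow> real^'m \<Rightarrow> real^'k) \<Rightarrow> real^'n \<Rightarrow> real^'m \<Rightarrow> real^'m^'k" where
  "jac2 F x y = jacobian (\<lambda>w. F x w) (at y)"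

(* E is the set of points at which the chosen branch Y exists; values of Y outside E are junk. *)

definition solution_branch ::
  "(real^'n \<Rightarrow> real^'m \<Rightarrow> real^'m) \<Rightarrow> (real^'n) set \<Rightarrow> (real^'n \<Rightarrow> real^'m) \<Rightarrow> bool" where
  "solution_branch g E Y \<longleftrightarrow> (\<forall>x\<in>E. g x (Y x) = 0)"

definition regular_domain ::
  "(real^'n \<Rightarrow> real^'m \<Rightarrow> real^'m) \<Rightarrow> (real^'n) set \<Rightarrow> (real^'n \<Rightarrow> real^'m) \<Rightarrow> (real^'n) set" where
  "regular_domain g E Y = {x \<in> E. det (jac2 g x (Y x)) \<noteq> 0}"

definition metric_function_on :: "(real^'n) set \<Rightarrow> (real^'n \<Rightarrow> real^'n^'n) \<Rightarrow> bool" where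
  "metric_function_on S \<theta> \<longleftrightarrow> (\<forall>x\<in>S. \<theta> differentiable (at x) \<and> invertible (\<theta> x))"

definition partial_derivative ::
  "(real^'n \<Rightarrow> 'b::real_normed_vector) \<Rightarrow> 'n \<Rightarrow> real^'n \<Rightarrow> 'b" where
  "partial_derivative F i x = vector_derivative (\<lambda>t. F (x + t *\<^sub>R axis i 1)) (at 0)"

(* Derivative of \<theta> along the vector field of the reduced system x' = f x (Y x). *)

definition trajectory_derivative ::
  "(real^'n \<Rightarrow> real^'m \<Rightarrow> real^'n) \<Rightarrow> (real^'n \<Rightarrow> real^'m) \<Rightarrow> (real^'n \<Rightarrow> real^'n^'n)
     \<Rightarrow> real^'n \<Rightarrow> real^'n^'n" where
  "trajectory_derivative f Y \<theta> x =
     (\<Sum>i\<in>UNIV. (f x (Y x) $ i) *\<^sub>R partial_derivative \<theta> i x)"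

definition reduced_jacobian ::
  "(real^'n \<Rightarrow> real^'m \<Rightarrow> real^'n) \<Rightarrow> (real^'n \<Rightarrow> real^'m \<Rightarrow> real^'m) \<Rightarrow> (real^'n \<Rightarrow> real^'m)
     \<Rightarrow> (real^'n \<Rightarrow> real^'n^'n) \<Rightarrow> real^'n \<Rightarrow> real^'n^'n" where
  "reduced_jacobian f g Y \<theta> x =
    (let A = jac1 f x (Y x); B = jac2 f x (Y x); C = jac1 g x (Y x); D = jac2 g x (Y x)
     in trajectory_derivative f Y \<theta> x ** matrix_inv (\<theta> x)
        + \<theta> x ** (A - B ** matrix_inv D ** C) ** matrix_inv (\<theta> x))"

definition unreduced_jacobian ::
  "(real^'n \<Rightarrow> real^'m \<Rightarrow> real^'n) \<Rightarrow> (real^'n \<Rightarrow> real^'m \<Rightarrow> real^'m) \<Rightarrow> (real^'n \<Rightarrow> real^'m)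
     \<Rightarrow> (real^'n \<Rightarrow> real^'n^'n) \<Rightarrow> (real^'n \<Rightarrow> real^'m^'m) \<Rightarrow> (real^'n \<Rightarrow> real^'n^'m)
     \<Rightarrow> (real^'n \<Rightarrow> real^'m^'m) \<Rightarrow> real^'n \<Rightarrow> real^('n + 'm)^('n + 'm)" where
  "unreduced_jacobian f g Y \<theta> Q R \<rho> x =
    (let C = jac1 g x (Y x); D = jac2 g x (Y x)
     in block_matrix
          (reduced_jacobian f g Y \<theta> x + \<theta> x ** transpose (R x) ** C ** matrix_inv (\<theta> x))
          (\<theta> x ** transpose (R x) ** D ** matrix_inv (\<rho> x))
          (transpose (Q x) ** C ** matrix_inv (\<theta> x))
          (transpose (Q x) ** D ** matrix_inv (\<rho> x)))"

end

theory Submission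
  imports Defs
begin

text \<open>
  Put \<open>K = [1; -S]\<close>. The block structure gives \<open>F K = [F\<^sub>r; 0]\<close>, so for a unit vector \<open>v\<close> the vector
  \<open>(1 + hF) K v\<close> equals \<open>[v + h F\<^sub>r v; -S v]\<close>: only the upper block moves. Since the \<open>p\<close>-norm of a
  stacked vector is a monotone function of the norms of its two blocks, replacing \<open>v + h F\<^sub>r v\<close> by
  a multiple of \<open>v\<close> of the same norm and applying the triangle inequality turns the contraction
  of \<open>K v\<close> by the factor \<open>\<kappa> = \<parallel>1 + hF\<parallel> < 1\<close> into \<open>\<parallel>v + h F\<^sub>r v\<parallel> \<le> 1 - (1 - \<kappa>) \<parallel>K v\<parallel>\<close>. Moreover
  \<open>\<parallel>K v\<parallel> = \<parallel>H v\<parallel> \<ge> \<nu>(H)\<close>, and dividing by \<open>h\<close> gives the claim in the limit.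
\<close>

subsection \<open>The \<open>p\<close>-norm\<close>

lemma exponent_cases:
  fixes p :: ereal
  assumes "1 \<le> p"
  obtains (inf) "p = \<infinity>" | (fin) r where "p = ereal r" "1 \<le> r"
  using assms by (cases p) auto

lemma pnorm_inf: "pnorm \<infinity> x = infnorm x"
  by (simp add: pnorm_def)

lemma pnorm_ereal: "pnorm (ereal r) x = (\<Sum>i\<in>UNIV. \<bar>x $ i\<bar> powr r) powr (1 / r)"
  by (simp add: pnorm_def)

lemma pnorm_ereal_powr:
  assumes "1 \<le> r"
  shows "pnorm (ereal r) x powr r = (\<Sum>i\<in>UNIV. \<bar>x $ i\<bar> powr r)"
  using assms by (simp add: pnorm_ereal powr_powr sum_nonneg)

lemma pnorm_nonneg [simp]: "0 \<le> pnorm p x"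
  by (simp add: pnorm_def infnorm_pos_le)

text \<open>For a finite exponent, one summand is at most the whole sum of nonnegative powers.
  Definiteness of the norm and boundedness of its unit sphere rest on this.\<close>

lemma component_le_pnorm:
  fixes x :: "real^'k"
  assumes "1 \<le> p"
  shows "\<bar>x $ i\<bar> \<le> pnorm p x"
  using assms
proof (cases p rule: exponent_cases)
  case inf
  then show ?thesis by (simp add: pnorm_inf component_le_infnorm_cart)
next
  case (fin r)
  have "\<bar>x $ i\<bar> powr r \<le> pnorm p x powr r"
    unfolding fin(1) pnorm_ereal_powr[OF fin(2)] by (rule member_le_sum) auto
  then show ?thesis
    using fin(2) powr_less_mono2[of r "pnorm p x" "\<bar>x $ i\<bar>"] by force
qed

lemma pnorm_zero [simp]: "pnorm p 0 = 0"
  by (simp add: pnorm_def infnorm_0)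

lemma pnorm_eq_zero:
  fixes x :: "real^'k"
  assumes "1 \<le> p"
  shows "pnorm p x = 0 \<longleftrightarrow> x = 0"
proof
  assume "pnorm p x = 0"
  then have "\<bar>x $ i\<bar> \<le> 0" for i using component_le_pnorm[OF assms, of x i] by simp
  then show "x = 0" by (simp add: vec_eq_iff)
qed simp

lemma pnorm_scaleR:
  fixes x :: "real^'k"
  assumes "1 \<le> p"
  shows "pnorm p (c *\<^sub>R x) = \<bar>c\<bar> * pnorm p x"
  using assms
proof (cases p rule: exponent_cases)
  case inf
  then show ?thesis by (simp add: pnorm_inf infnorm_mul)
next
  case (fin r)
  then show ?thesis
    by (simp add: pnorm_ereal abs_mult powr_mult powr_powr sum_nonneg flip: sum_distrib_left)
qed

section \<open>Convexity and Minkowski's inequality\<close>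

lemma convex_abs_powr:
  fixes a b t :: real
  assumes "1 \<le> r" "0 \<le> t" "t \<le> 1"
  shows "\<bar>t * a + (1 - t) * b\<bar> powr r \<le> t * \<bar>a\<bar> powr r + (1 - t) * \<bar>b\<bar> powr r"
proof -
  \<comment> \<open>This covers a zero argument below, where only one summand survives.\<close>
  have scale: "(s * c) powr r \<le> s * c powr r" if "0 \<le> s" "s \<le> 1" "0 \<le> c" for s c :: real
  proof -
    have "s powr r \<le> s"
      using that assms(1) powr_mono'[of 1 r s] by simp
    then show ?thesis using that by (simp add: powr_mult mult_right_mono)
  qed
  have "\<bar>t * a + (1 - t) * b\<bar> \<le> t * \<bar>a\<bar> + (1 - t) * \<bar>b\<bar>"
    using assms abs_triangle_ineq[of "t * a" "(1 - t) * b"] by (simp add: abs_mult)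
  then have "\<bar>t * a + (1 - t) * b\<bar> powr r \<le> (t * \<bar>a\<bar> + (1 - t) * \<bar>b\<bar>) powr r"
    using assms by (intro powr_mono2) auto
  also have "\<dots> \<le> t * \<bar>a\<bar> powr r + (1 - t) * \<bar>b\<bar> powr r"
  proof (cases "a = 0 \<or> b = 0")
    case True
    then show ?thesis using scale[of t "\<bar>a\<bar>"] scale[of "1 - t" "\<bar>b\<bar>"] assms by auto
  next
    case False
    then show ?thesis
      using convex_onD[OF powr_convex[OF assms(1)], of "1 - t" "\<bar>a\<bar>" "\<bar>b\<bar>"] assms by simp
  qed
  finally show ?thesis .
qed

lemma pnorm_ereal_convex:
  fixes x y :: "real^'k"
  assumes r: "1 \<le> r" and t: "0 \<le> t" "t \<le> 1"
    and "pnorm (ereal r) x = 1" "pnorm (ereal r) y = 1"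
  shows "pnorm (ereal r) (t *\<^sub>R x + (1 - t) *\<^sub>R y) \<le> 1"
proof -
  have "(\<Sum>i\<in>UNIV. \<bar>(t *\<^sub>R x + (1 - t) *\<^sub>R y) $ i\<bar> powr r)
      \<le> (\<Sum>i\<in>UNIV. t * \<bar>x $ i\<bar> powr r + (1 - t) * \<bar>y $ i\<bar> powr r)"
    by (rule sum_mono) (simp add: convex_abs_powr[OF r t])
  also have "\<dots> = 1"
    using assms(4,5) pnorm_ereal_powr[OF r, of x] pnorm_ereal_powr[OF r, of y]
    by (simp add: sum.distrib flip: sum_distrib_left)
  finally have "(\<Sum>i\<in>UNIV. \<bar>(t *\<^sub>R x + (1 - t) *\<^sub>R y) $ i\<bar> powr r) \<le> 1" .
  then show ?thesis
    unfolding pnorm_ereal using powr_mono2[of "1/r" _ 1] r by (simp add: sum_nonneg)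
qed

text \<open>For finite exponents this is Minkowski's inequality, from convexity of the unit ball:
  \<open>x + y\<close> is \<open>?a + ?b\<close> times a convex combination of the normalised
  vectors, with weights proportional to their norms.\<close>

lemma pnorm_triangle:
  fixes x y :: "real^'k"
  assumes p: "1 \<le> p"
  shows "pnorm p (x + y) \<le> pnorm p x + pnorm p y"
  using p
proof (cases p rule: exponent_cases)
  case inf
  then show ?thesis by (simp add: pnorm_inf infnorm_triangle)
next
  case (fin r)
  let ?a = "pnorm p x" and ?b = "pnorm p y"
  show ?thesis
  proof (cases "x = 0 \<or> y = 0")
    case False
    then have pos: "?a > 0" "?b > 0"
      using pnorm_eq_zero[OF p] pnorm_nonneg by (metis order_le_less)+
    define t where "t = ?a / (?a + ?b)"
    have t: "0 \<le> t" "t \<le> 1" "1 - t = ?b / (?a + ?b)"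
      using pos by (auto simp: t_def field_simps)
    have "x + y = (?a + ?b) *\<^sub>R (t *\<^sub>R ((1 / ?a) *\<^sub>R x) + (1 - t) *\<^sub>R ((1 / ?b) *\<^sub>R y))"
      using pos unfolding t(3) unfolding t_def by (simp add: scaleR_add_right)
    moreover have "pnorm p (t *\<^sub>R ((1 / ?a) *\<^sub>R x) + (1 - t) *\<^sub>R ((1 / ?b) *\<^sub>R y)) \<le> 1"
      unfolding fin(1)
      by (rule pnorm_ereal_convex[OF fin(2) t(1,2)])
        (use pos in \<open>simp_all add: fin(1)[symmetric] pnorm_scaleR[OF p]\<close>)
    ultimately show ?thesis
      using pos by (simp only: pnorm_scaleR[OF p]) (simp add: mult_left_le)
  qed auto
qed

lemma pnorm_uminus:
  fixes x :: "real^'k"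
  assumes "1 \<le> p"
  shows "pnorm p (- x) = pnorm p x"
  using pnorm_scaleR[OF assms, of "-1" x] by simp

section \<open>Continuity of the norm and compactness of its unit sphere\<close>

lemma continuous_on_pnorm:
  assumes "1 \<le> p"
  shows "continuous_on A (pnorm p :: real^'k \<Rightarrow> real)"
  using assms
proof (cases p rule: exponent_cases)
  case inf
  have "continuous_on A (infnorm :: real^'k \<Rightarrow> real)"
    by (intro continuous_at_imp_continuous_on ballI continuous_infnorm continuous_ident)
  then show ?thesis using inf by (simp add: pnorm_def[abs_def])
next
  case (fin r)
  then show ?thesis
    unfolding fin(1) pnorm_ereal[abs_def]
    by (intro continuous_on_powr' continuous_intros) (auto intro: sum_nonneg)
qed

lemma compact_pnorm_sphere:
  assumes "1 \<le> p"
  shows "compact {v :: real^'k. pnorm p v = 1}"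
proof -
  have "closed {v :: real^'k. pnorm p v = 1}"
    by (intro closed_Collect_eq continuous_on_pnorm assms continuous_intros)
  moreover have "norm v \<le> real CARD('k)" if "pnorm p v = 1" for v :: "real^'k"
  proof -
    have "norm v \<le> (\<Sum>i\<in>UNIV. \<bar>v $ i\<bar>)" by (rule norm_le_l1_cart)
    also have "\<dots> \<le> (\<Sum>i\<in>(UNIV::'k set). 1)"
      using component_le_pnorm[OF assms, of v] that by (intro sum_mono) simp
    finally show ?thesis by simp
  qed
  then have "bounded {v :: real^'k. pnorm p v = 1}" by (auto simp: bounded_iff)
  ultimately show ?thesis by (simp add: compact_eq_bounded_closed)
qed

lemma pnorm_normalize:
  fixes v :: "real^'k"
  assumes "1 \<le> p" "v \<noteq> 0"
  shows "pnorm p ((1 / pnorm p v) *\<^sub>R v) = 1"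
  using assms pnorm_eq_zero[OF assms(1), of v] by (simp add: pnorm_scaleR)

lemma pnorm_sphere_nonempty:
  assumes "1 \<le> p"
  shows "\<exists>v :: real^'k. pnorm p v = 1"
proof -
  have "axis undefined 1 \<noteq> (0 :: real^'k)" by (simp add: axis_eq_0_iff)
  then show ?thesis using pnorm_normalize[OF assms] by blast
qed

subsection \<open>Operator norm and matrix measure\<close>

lemma continuous_on_pnorm_matrix:
  fixes M :: "real^'k^'l"
  assumes "1 \<le> p"
  shows "continuous_on A (\<lambda>v. pnorm p (M *v v))"
  by (rule continuous_on_compose2[OF continuous_on_pnorm[OF assms, of UNIV]])
    (auto intro: linear_continuous_on)

text \<open>A real \<open>SUP\<close> is an upper bound only for a set bounded above; the continuous
  image of the compact sphere is such a set.\<close>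

lemma op_pnorm_unit:
  fixes M :: "real^'k^'l"
  assumes "1 \<le> p" "pnorm p v = 1"
  shows "pnorm p (M *v v) \<le> op_pnorm p M"
proof -
  have "compact ((\<lambda>v. pnorm p (M *v v)) ` {v. pnorm p v = 1})"
    by (intro compact_continuous_image continuous_on_pnorm_matrix compact_pnorm_sphere assms)
  then have "bdd_above ((\<lambda>v. pnorm p (M *v v)) ` {v. pnorm p v = 1})"
    by (intro bounded_imp_bdd_above compact_imp_bounded)
  then show ?thesis
    unfolding op_pnorm_def using assms(2) by (intro cSUP_upper) auto
qed

lemma op_pnorm_bound:
  fixes M :: "real^'k^'l"
  assumes p: "1 \<le> p"
  shows "pnorm p (M *v v) \<le> op_pnorm p M * pnorm p v"
proof (cases "v = 0")
  case False
  then have "pnorm p v > 0" using pnorm_eq_zero[OF p, of v] pnorm_nonneg[of p v] by linarith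
  then show ?thesis
    using op_pnorm_unit[OF p pnorm_normalize[OF p False], of M]
    by (simp add: matrix_vector_mult_scaleR pnorm_scaleR[OF p] field_simps)
qed simp

lemma op_pnorm_least:
  fixes M :: "real^'k^'l"
  assumes "1 \<le> p" "\<And>v. pnorm p v = 1 \<Longrightarrow> pnorm p (M *v v) \<le> c"
  shows "op_pnorm p M \<le> c"
  unfolding op_pnorm_def
  using assms pnorm_sphere_nonempty[OF assms(1)] by (intro cSUP_least) auto

lemma op_pnorm_mat1:
  assumes p: "1 \<le> p"
  shows "op_pnorm p (mat 1 :: real^'k^'k) = 1"
proof (rule antisym)
  show "op_pnorm p (mat 1 :: real^'k^'k) \<le> 1"
    by (rule op_pnorm_least[OF p]) simp
  obtain v :: "real^'k" where "pnorm p v = 1"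
    using pnorm_sphere_nonempty[OF p] by blast
  then show "1 \<le> op_pnorm p (mat 1 :: real^'k^'k)"
    using op_pnorm_unit[OF p, of v "mat 1"] by simp
qed

lemma op_pnorm_triangle:
  fixes M N :: "real^'k^'l"
  assumes p: "1 \<le> p"
  shows "op_pnorm p (M + N) \<le> op_pnorm p M + op_pnorm p N"
proof (rule op_pnorm_least[OF p])
  fix v :: "real^'k" assume "pnorm p v = 1"
  then show "pnorm p ((M + N) *v v) \<le> op_pnorm p M + op_pnorm p N"
    using pnorm_triangle[OF p, of "M *v v" "N *v v"] op_pnorm_unit[OF p, of v M]
      op_pnorm_unit[OF p, of v N]
    by (simp add: matrix_vector_mult_add_rdistrib)
qed

lemma op_pnorm_scaleR_le:
  fixes M :: "real^'k^'l"
  assumes p: "1 \<le> p"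
  shows "op_pnorm p (c *\<^sub>R M) \<le> \<bar>c\<bar> * op_pnorm p M"
  by (rule op_pnorm_least[OF p])
    (simp add: scaleR_matrix_vector_assoc[symmetric] pnorm_scaleR[OF p] mult_left_mono
      op_pnorm_unit[OF p])

text \<open>Convexity of the norm makes the difference quotient monotone in \<open>h\<close>, so that the limit exists.\<close>

lemma matrix_measure_tendsto:
  fixes M :: "real^'k^'k"
  assumes p: "1 \<le> p"
  shows "((\<lambda>h. (op_pnorm p (mat 1 + h *\<^sub>R M) - 1) / h) \<longlongrightarrow> matrix_measure p M) (at_right 0)"
proof -
  let ?q = "\<lambda>h. (op_pnorm p (mat 1 + h *\<^sub>R M) - 1) / h"
  have mono: "?q h \<le> ?q k" if "0 < h" "h \<le> k" for h k
  proof -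
    define t where "t = h / k"
    have t: "0 < t" "t \<le> 1" "h = t * k" using that by (auto simp: t_def)
    \<comment> \<open>The perturbed identity for the smaller step lies on the segment from
      \<open>mat 1\<close> to the one for the larger step.\<close>
    have "mat 1 + h *\<^sub>R M = (1 - t) *\<^sub>R mat 1 + t *\<^sub>R (mat 1 + k *\<^sub>R M)"
      by (simp add: t(3) algebra_simps)
    also have "op_pnorm p \<dots> \<le> (1 - t) * 1 + t * op_pnorm p (mat 1 + k *\<^sub>R M)"
      using op_pnorm_triangle[OF p, of "(1 - t) *\<^sub>R mat 1" "t *\<^sub>R (mat 1 + k *\<^sub>R M)"]
        op_pnorm_scaleR_le[OF p, of "1 - t" "mat 1 :: real^'k^'k"]
        op_pnorm_scaleR_le[OF p, of t "mat 1 + k *\<^sub>R M"] t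
      by (simp add: op_pnorm_mat1[OF p])
    finally have "op_pnorm p (mat 1 + h *\<^sub>R M) - 1 \<le> t * (op_pnorm p (mat 1 + k *\<^sub>R M) - 1)"
      by (simp add: algebra_simps)
    then have "?q h \<le> t * (op_pnorm p (mat 1 + k *\<^sub>R M) - 1) / h"
      using that by (simp add: divide_right_mono)
    also have "\<dots> = ?q k" using that by (simp add: t_def)
    finally show ?thesis .
  qed
  have bnd: "- op_pnorm p M \<le> ?q h" if "0 < h" for h
  proof -
    \<comment> \<open>Writing the identity as \<open>(mat 1 + h *\<^sub>R M) - h *\<^sub>R M\<close>
      bounds the quotient below, uniformly in \<open>h\<close>.\<close>
    have "1 = op_pnorm p ((mat 1 + h *\<^sub>R M) + (- h) *\<^sub>R M)"
      by (simp add: op_pnorm_mat1[OF p])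
    also have "\<dots> \<le> op_pnorm p (mat 1 + h *\<^sub>R M) + h * op_pnorm p M"
      using op_pnorm_triangle[OF p, of "mat 1 + h *\<^sub>R M" "(- h) *\<^sub>R M"]
        op_pnorm_scaleR_le[OF p, of "- h" M] that by linarith
    finally show ?thesis using that by (simp add: field_simps)
  qed
  have lim: "(?q \<longlongrightarrow> Inf (?q ` ({0<..} \<inter> UNIV))) (at 0 within ({0<..} \<inter> UNIV))"
    by (rule Lim_right_bound[where K = "- op_pnorm p M"]) (use mono bnd in auto)
  then show ?thesis
    unfolding matrix_measure_def using tendsto_Lim[OF _ lim] by simp
qed

text \<open>Compactness of the sphere provides a minimiser, so the \<open>LEAST\<close> in
  \<open>min_gain\<close> is a genuine minimum.\<close>

lemma min_gain_le:
  fixes M :: "real^'k^'l"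
  assumes p: "1 \<le> p" and v: "pnorm p v = 1"
  shows "min_gain p M \<le> pnorm p (M *v v)"
proof -
  obtain u where u: "pnorm p u = 1" "\<And>w. pnorm p w = 1 \<Longrightarrow> pnorm p (M *v u) \<le> pnorm p (M *v w)"
    using continuous_attains_inf[OF compact_pnorm_sphere[OF p] _ continuous_on_pnorm_matrix[OF p, of _ M]] v
    by blast
  then have "min_gain p M = pnorm p (M *v u)"
    unfolding min_gain_def by (intro Least_equality) auto
  then show ?thesis using u(2)[OF v] by simp
qed

subsection \<open>Stacked vectors and block matrices\<close>

definition vec_stack :: "real^'n \<Rightarrow> real^'m \<Rightarrow> real^('n + 'm)" where
  "vec_stack a b = (\<chi> i. case i of Inl j \<Rightarrow> a $ j | Inr k \<Rightarrow> b $ k)"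

lemma vec_stack_nth [simp]:
  "vec_stack a b $ Inl j = a $ j" "vec_stack a b $ Inr k = b $ k"
  by (simp_all add: vec_stack_def)

lemma vec_stack_eqI:
  assumes "\<And>j. x $ Inl j = a $ j" "\<And>k. x $ Inr k = b $ k"
  shows "x = vec_stack a b"
  unfolding vec_eq_iff using assms by (metis sum.exhaust vec_stack_nth)

lemma sum_UNIV_sum:
  fixes f :: "'a::finite + 'b::finite \<Rightarrow> 'c::comm_monoid_add"
  shows "sum f UNIV = (\<Sum>i\<in>UNIV. f (Inl i)) + (\<Sum>j\<in>UNIV. f (Inr j))"
  using sum.Plus[of UNIV UNIV f] by (simp add: comp_def)

lemma vstack_mult: "vstack M N *v v = vec_stack (M *v v) (N *v v)"
  by (rule vec_stack_eqI) (simp_all add: vstack_def matrix_vector_mult_def)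

lemma hstack_mult: "hstack M N *v vec_stack a b = M *v a + N *v b"
  by (simp add: vec_eq_iff hstack_def matrix_vector_mult_def sum_UNIV_sum)

lemma block_matrix_mult:
  "block_matrix M11 M12 M21 M22 *v vec_stack a b
     = vec_stack (M11 *v a + M12 *v b) (M21 *v a + M22 *v b)"
  by (simp add: block_matrix_def vstack_mult hstack_mult)

lemma vec_stack_add: "vec_stack a b + vec_stack c d = vec_stack (a + c) (b + d)"
  by (rule vec_stack_eqI) simp_all

lemma vec_stack_scaleR: "h *\<^sub>R vec_stack a b = vec_stack (h *\<^sub>R a) (h *\<^sub>R b)"
  by (rule vec_stack_eqI) simp_all

lemma infnorm_le_iff: "infnorm (x :: real^'k) \<le> c \<longleftrightarrow> (\<forall>i. \<bar>x $ i\<bar> \<le> c)"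
proof
  assume "\<forall>i. \<bar>x $ i\<bar> \<le> c"
  then show "infnorm x \<le> c" unfolding infnorm_cart by (intro cSup_least) auto
qed (meson component_le_infnorm_cart order_trans)

lemma infnorm_vec_stack: "infnorm (vec_stack a b) = max (infnorm a) (infnorm b)"
proof (rule antisym)
  have "\<bar>vec_stack a b $ i\<bar> \<le> max (infnorm a) (infnorm b)" for i
    by (cases i) (auto simp: le_max_iff_disj component_le_infnorm_cart)
  then show "infnorm (vec_stack a b) \<le> max (infnorm a) (infnorm b)"
    by (simp add: infnorm_le_iff)
  show "max (infnorm a) (infnorm b) \<le> infnorm (vec_stack a b)"
    by (metis component_le_infnorm_cart infnorm_le_iff max.boundedI vec_stack_nth)
qed

lemma pnorm_vec_stack_ereal:
  assumes "1 \<le> r"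
  shows "pnorm (ereal r) (vec_stack a b)
     = (pnorm (ereal r) a powr r + pnorm (ereal r) b powr r) powr (1 / r)"
  by (simp add: pnorm_ereal_powr[OF assms] sum_UNIV_sum pnorm_ereal[of r "vec_stack a b"])

text \<open>The norm of a stacked vector is the \<open>p\<close>-norm of the pair of block norms,
  and that is monotone in both entries.\<close>

lemma pnorm_vec_stack_mono:
  assumes "1 \<le> p" "pnorm p a \<le> pnorm p c" "pnorm p b \<le> pnorm p d"
  shows "pnorm p (vec_stack a b) \<le> pnorm p (vec_stack c d)"
  using assms(1)
proof (cases p rule: exponent_cases)
  case inf
  then show ?thesis using assms by (auto simp: pnorm_inf infnorm_vec_stack)
next
  case (fin r)
  then show ?thesis
    using assms by (auto simp: pnorm_vec_stack_ereal intro!: powr_mono2 add_mono)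
qed

lemma pnorm_vec_stack_zero:
  assumes "1 \<le> p"
  shows "pnorm p (vec_stack a 0) = pnorm p a"
  using assms
proof (cases p rule: exponent_cases)
  case inf
  then show ?thesis by (simp add: pnorm_inf infnorm_vec_stack infnorm_0 infnorm_pos_le)
next
  case (fin r)
  then show ?thesis by (simp add: pnorm_vec_stack_ereal powr_powr)
qed

text \<open>Turns a contraction of the whole stacked vector into a bound on the upper block, given
  that the lower block stays fixed.\<close>

lemma pnorm_vec_stack_contraction:
  fixes a v :: "real^'n" and b :: "real^'m"
  assumes p: "1 \<le> p" and v: "pnorm p v = 1" and k: "\<kappa> < 1"
    and le: "pnorm p (vec_stack a b) \<le> \<kappa> * pnorm p (vec_stack v b)"
  shows "pnorm p a \<le> 1 - (1 - \<kappa>) * pnorm p (vec_stack v b)"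
proof -
  let ?N = "pnorm p (vec_stack v b)" and ?\<alpha> = "pnorm p a"
  have "1 \<le> ?N"
    using pnorm_vec_stack_mono[OF p, of v v 0 b] v by (simp add: pnorm_vec_stack_zero[OF p])
  then have "pnorm p (vec_stack a b) < ?N"
    using le k by (smt (verit) mult_less_cancel_right2)
  \<comment> \<open>Otherwise monotonicity in the upper block would make the contracted vector at
    least as long as the original.\<close>
  then have \<alpha>: "?\<alpha> \<le> 1"
    using pnorm_vec_stack_mono[OF p, of v a b b] v by linarith
  \<comment> \<open>The vector \<open>?\<alpha> *\<^sub>R v\<close> has the same norm as
    \<open>a\<close>, so the first summand is no longer than \<open>vec_stack a b\<close>; the
    second has norm \<open>1 - ?\<alpha>\<close>.\<close>
  have split: "vec_stack v b = vec_stack (?\<alpha> *\<^sub>R v) b + vec_stack ((1 - ?\<alpha>) *\<^sub>R v) 0"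
    by (simp add: vec_stack_add algebra_simps)
  have "?N \<le> pnorm p (vec_stack (?\<alpha> *\<^sub>R v) b)
      + pnorm p (vec_stack ((1 - ?\<alpha>) *\<^sub>R v) (0 :: real^'m))"
    by (subst split) (rule pnorm_triangle[OF p])
  also have "\<dots> \<le> pnorm p (vec_stack a b) + (1 - ?\<alpha>)"
    using \<alpha> v by (intro add_mono pnorm_vec_stack_mono[OF p])
      (simp_all add: pnorm_vec_stack_zero[OF p] pnorm_scaleR[OF p])
  finally show ?thesis using le by (simp add: algebra_simps)
qed

section \<open>Comparison of the matrix measures\<close>

lemma matrix_measure_reduction:
  fixes F :: "real^('n::finite + 'm::finite)^('n + 'm)" and Fr :: "real^'n^'n" and S :: "real^'n^'m"
  assumes p: "1 \<le> p" and neg: "matrix_measure p F < 0"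
    and F: "\<And>v. F *v vec_stack v (- (S *v v)) = vec_stack (Fr *v v) 0"
  shows "matrix_measure p Fr \<le> matrix_measure p F * min_gain p (vstack (mat 1) S)"
proof -
  let ?\<nu> = "min_gain p (vstack (mat 1) S)"
  let ?q = "\<lambda>h. (op_pnorm p (mat 1 + h *\<^sub>R F) - 1) / h"
  \<comment> \<open>The claim at a fixed step size, before dividing by \<open>h\<close>.\<close>
  have bound: "op_pnorm p (mat 1 + h *\<^sub>R Fr) \<le> 1 + (\<kappa> - 1) * ?\<nu>"
    if \<kappa>: "\<kappa> = op_pnorm p (mat 1 + h *\<^sub>R F)" "\<kappa> < 1" for h \<kappa>
  proof (rule op_pnorm_least[OF p])
    fix v :: "real^'n" assume v: "pnorm p v = 1"
    let ?K = "vec_stack v (- (S *v v))" and ?a = "(mat 1 + h *\<^sub>R Fr) *v v"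
    have "vec_stack ?a (- (S *v v)) = (mat 1 + h *\<^sub>R F) *v ?K"
      by (simp add: matrix_vector_mult_add_rdistrib scaleR_matrix_vector_assoc[symmetric] F
          vec_stack_scaleR vec_stack_add)
    then have "pnorm p (vec_stack ?a (- (S *v v))) \<le> \<kappa> * pnorm p ?K"
      using op_pnorm_bound[OF p] \<kappa>(1) by metis
    then have "pnorm p ?a \<le> 1 - (1 - \<kappa>) * pnorm p ?K"
      by (rule pnorm_vec_stack_contraction[OF p v \<kappa>(2)])
    moreover have "?\<nu> \<le> pnorm p ?K"
    proof -
      \<comment> \<open>Only the sign of the lower block differs, which its norm ignores.\<close>
      have "pnorm p (vstack (mat 1) S *v v) \<le> pnorm p ?K"
        unfolding vstack_mult matrix_vector_mul_lid
        by (rule pnorm_vec_stack_mono[OF p]) (simp_all add: pnorm_uminus[OF p])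
      then show ?thesis using min_gain_le[OF p v, of "vstack (mat 1) S"] by linarith
    qed
    then have "(1 - \<kappa>) * ?\<nu> \<le> (1 - \<kappa>) * pnorm p ?K"
      using \<kappa>(2) by (intro mult_left_mono) auto
    ultimately show "pnorm p ?a \<le> 1 + (\<kappa> - 1) * ?\<nu>" by (simp add: algebra_simps)
  qed
  \<comment> \<open>A negative limit makes the quotient negative for small \<open>h\<close>, which
    is the condition \<open>\<kappa> < 1\<close> of \<open>bound\<close>.\<close>
  have "eventually (\<lambda>h. ?q h < 0) (at_right 0)"
    using order_tendstoD(2)[OF matrix_measure_tendsto[OF p] neg] .
  moreover have "eventually (\<lambda>h::real. 0 < h) (at_right 0)"
    by (rule eventually_at_right_less)
  ultimately have "eventually (\<lambda>h. (op_pnorm p (mat 1 + h *\<^sub>R Fr) - 1) / h \<le> ?q h * ?\<nu>) (at_right 0)"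
  proof eventually_elim
    case (elim h)
    then have "op_pnorm p (mat 1 + h *\<^sub>R F) < 1" by (simp add: divide_less_0_iff)
    from bound[OF refl this]
    have "op_pnorm p (mat 1 + h *\<^sub>R Fr) - 1 \<le> (op_pnorm p (mat 1 + h *\<^sub>R F) - 1) * ?\<nu>"
      by simp
    from divide_right_mono[OF this, of h] elim show ?case by simp
  qed
  then show ?thesis
    by (rule tendsto_le[OF trivial_limit_at_right_real
          tendsto_mult_right[OF matrix_measure_tendsto[OF p]] matrix_measure_tendsto[OF p]])
qed

section \<open>The Jacobians of the differential-algebraic system\<close>

lemma matrix_inv_cancel:
  fixes M :: "real^'k^'k"
  assumes "invertible M"
  shows "M ** matrix_inv M = mat 1" "matrix_inv M ** M = mat 1"
proof -
  have "M ** matrix_inv M = mat 1 \<and> matrix_inv M ** M = mat 1"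
    unfolding matrix_inv_def using assms unfolding invertible_def by (rule someI_ex)
  then show "M ** matrix_inv M = mat 1" "matrix_inv M ** M = mat 1" by simp_all
qed

text \<open>The choice of \<open>S\<close> gives
  \<open>D ** matrix_inv \<rho> ** S = C ** matrix_inv \<theta>\<close>. Hence the two
  \<open>R\<close> terms of the upper row cancel, as do the two \<open>Q\<close> terms of the lower
  row, whatever \<open>Q\<close> and \<open>R\<close> are.\<close>

lemma unreduced_jacobian_mult:
  fixes f :: "real^'n \<Rightarrow> real^'m \<Rightarrow> real^'n" and g :: "real^'n \<Rightarrow> real^'m \<Rightarrow> real^'m"
    and Y :: "real^'n \<Rightarrow> real^'m" and \<theta> :: "real^'n \<Rightarrow> real^'n^'n"
    and Q \<rho> :: "real^'n \<Rightarrow> real^'m^'m" and R :: "real^'n \<Rightarrow> real^'n^'m" and S :: "real^'n^'m"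
  assumes D: "invertible (jac2 g x (Y x))" and \<rho>: "invertible (\<rho> x)"
    and S: "S = \<rho> x ** matrix_inv (jac2 g x (Y x)) ** jac1 g x (Y x) ** matrix_inv (\<theta> x)"
  shows "unreduced_jacobian f g Y \<theta> Q R \<rho> x *v vec_stack v (- (S *v v))
    = vec_stack (reduced_jacobian f g Y \<theta> x *v v) 0"
proof -
  let ?C = "jac1 g x (Y x)" and ?D = "jac2 g x (Y x)" and ?T = "matrix_inv (\<theta> x)"
  have cancel: "?D ** matrix_inv (\<rho> x) ** S = ?C ** ?T"
  proof -
    have "?D ** matrix_inv (\<rho> x) ** S
      = ?D ** (matrix_inv (\<rho> x) ** \<rho> x) ** matrix_inv ?D ** ?C ** ?T"
      by (simp add: S matrix_mul_assoc)
    then show ?thesis by (simp add: matrix_inv_cancel[OF \<rho>] matrix_inv_cancel[OF D])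
  qed
  \<comment> \<open>The same identity as successive actions on \<open>v\<close>, the shape in which
    the terms appear once the block products are unfolded.\<close>
  have "?D *v (matrix_inv (\<rho> x) *v (S *v v)) = ?C *v (?T *v v)"
    using cancel by (simp add: matrix_vector_mul_assoc matrix_mul_assoc)
  then show ?thesis
    by (simp add: unreduced_jacobian_def Let_def block_matrix_mult matrix_vector_mult_add_rdistrib
        linear_neg[OF matrix_vector_mul_linear] flip: matrix_vector_mul_assoc)
qed

theorem theorem1:
  fixes f :: "real^'n \<Rightarrow> real^'m \<Rightarrow> real^'n"
    and g :: "real^'n \<Rightarrow> real^'m \<Rightarrow> real^'m"
    and Y :: "real^'n \<Rightarrow> real^'m"
    and E U :: "(real^'n) set"
    and \<theta> :: "real^'n \<Rightarrow> real^'n^'n"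
    and Q \<rho> :: "real^'n \<Rightarrow> real^'m^'m"
    and R :: "real^'n \<Rightarrow> real^'n^'m"
    and p :: ereal
  assumes "1 \<le> p"
    and "continuously_differentiable (\<lambda>(x, y). f x y)"
    and "continuously_differentiable (\<lambda>(x, y). g x y)"
    and "solution_branch g E Y"
    and "U \<subseteq> regular_domain g E Y"
    and "metric_function_on U \<theta>"
    and "\<And>x. x \<in> U \<Longrightarrow> invertible (\<rho> x)"
    and "\<And>x. x \<in> U \<Longrightarrow> matrix_measure p (unreduced_jacobian f g Y \<theta> Q R \<rho> x) < 0"
  shows "\<forall>x\<in>U.
    (let S = \<rho> x ** matrix_inv (jac2 g x (Y x)) ** jac1 g x (Y x) ** matrix_inv (\<theta> x);
         H = vstack (mat 1) S
     in matrix_measure p (reduced_jacobian f g Y \<theta> x)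
          \<le> matrix_measure p (unreduced_jacobian f g Y \<theta> Q R \<rho> x) * min_gain p H)"
proof
  fix x assume x: "x \<in> U"
  then have "invertible (jac2 g x (Y x))"
    using assms(5) by (auto simp: regular_domain_def invertible_det_nz)
  then show "let S = \<rho> x ** matrix_inv (jac2 g x (Y x)) ** jac1 g x (Y x) ** matrix_inv (\<theta> x);
         H = vstack (mat 1) S
     in matrix_measure p (reduced_jacobian f g Y \<theta> x)
          \<le> matrix_measure p (unreduced_jacobian f g Y \<theta> Q R \<rho> x) * min_gain p H"
    unfolding Let_def
    by (intro matrix_measure_reduction assms(1) assms(8)[OF x] unreduced_jacobian_mult
        assms(7)[OF x] refl)
qed

end
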